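(* Let $\Theta$ be a random variable with $\mathbb P(\Theta>0)=1$ and Laplace--Stieltjes transform $\mathcal L_\Theta(u)=\mathbb E[e^{-u\Theta}]$, assumed differentiable on $(0,\infty)$. Let $\lambda_1,\dots,\lambda_n>0$ and suppose that, conditionally on $\Theta=\theta$, the random variables $X_1,\dots,X_n$ are independent with $X_i\sim\mathrm{Exp}(\theta/\lambda_i)$ (exponential with rate $\theta/\lambda_i$). Let $S=\sum_{i=1}^nX_i$ with law $\mu_S$. For distinct $\lambda_1,\dots,\lambda_n$ define $$A_k(\boldsymbol\lambda):=\prod_{m\ne k}\frac{\lambda_k}{\lambda_k-\lambda_m}.$$ (i) If $\lambda_1,\dots,\lambda_n$ are distinct, then $S$ has density, for $s>0$, $$f_S(s)=-\sum_{k=1}^n\frac{A_k(\boldsymbol\lambda)}{\lambda_k}\,\mathcal L_\Theta'\Big(\frac{s}{\lambda_k}\Big),$$ and the corresponding (unconditional) expected allocation density is $$\xi_i(s)=-\frac{s}{\lambda_i}A_i(\boldsymbol\lambda)\,\mathcal L_\Theta'\Big(\frac{s}{\lambda_i}\Big)+\sum_{k\ne i}A_k(\boldsymbol\lambda)\frac{\lambda_i}{\lambda_i-\lambda_k}\Big(\mathcal L_\Theta\Big(\frac{s}{\lambda_i}\Big)-\mathcal L_\Theta\Big(\frac{s}{\lambda_k}\Big)\Big),\qquad i=1,\dots,n.$$ (ii) If $\lambda_1=\cdots=\lambda_n=\lambda$ and $S$ has a density $f_S$, then for each $i$ and $\mu_S$-almost every $s>0$, $$\xi_i(s)=\frac{s}{n}f_S(s),\qquad\mathbb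 E[X_i\mid S=s]=\frac{s}{n}.$$
   Context: The expected allocation density $\xi_i$ is the density with respect to Lebesgue measure on $(0,\infty)$ of the measure $\nu_i(B)=\mathbb E[X_i\mathbf 1_{\{S\in B\}}]$, $B\subseteq[0,\infty)$ Borel. For the nonnegative variable $X_i$ (possibly of infinite mean), $\mathbb E[X_i\mid S=s]$ denotes the Radon--Nikodym derivative $\frac{\mathrm d\nu_i}{\mathrm d\mu_S}(s)$. Empty products equal $1$. *)

theory Defs
  imports "HOL-Probability.Probability"
begin

text \<open>
  \<^term>\<open>K\<close> is a regular conditional distribution of the \<^term>\<open>N\<close>-valued random variable
  \<^term>\<open>Z\<close> given the \<^term>\<open>L\<close>-valued random variable \<^term>\<open>Y\<close>: a Markov kernel from
  \<^term>\<open>L\<close> to \<^term>\<open>N\<close> that disintegrates the joint law of \<^term>\<open>Y\<close> and \<^term>\<open>Z\<close>.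
\<close>
definition regular_cond_distr ::
    "'a measure \<Rightarrow> 'b measure \<Rightarrow> ('a \<Rightarrow> 'b) \<Rightarrow> 'c measure \<Rightarrow> ('a \<Rightarrow> 'c) \<Rightarrow> ('c \<Rightarrow> 'b measure) \<Rightarrow> bool"
  where "regular_cond_distr M N Z L Y K \<longleftrightarrow>
    Z \<in> M \<rightarrow>\<^sub>M N \<and> Y \<in> M \<rightarrow>\<^sub>M L \<and> K \<in> L \<rightarrow>\<^sub>M prob_algebra N \<and>
    (\<forall>A\<in>sets L. \<forall>B\<in>sets N.
       emeasure M {\<omega> \<in> space M. Y \<omega> \<in> A \<and> Z \<omega> \<in> B} =
         (\<integral>\<^sup>+y\<in>A. emeasure (K y) B \<partial>distr M L Y))"

definition laplace_stieltjes :: "'a measure \<Rightarrow> ('a \<Rightarrow> real) \<Rightarrow> real \<Rightarrow> real"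
  where "laplace_stieltjes M \<Theta> u = prob_space.expectation M (\<lambda>\<omega>. exp (- u * \<Theta> \<omega>))"

text \<open>
  For an almost surely nonnegative \<^term>\<open>Y\<close> (so that \<^term>\<open>ennreal\<close> truncates nothing) this is
  the measure sending \<^term>\<open>B\<close> to the expectation of \<^term>\<open>Y\<close> on the event that
  \<^term>\<open>S\<close> lies in \<^term>\<open>B\<close>; it may be infinite.
\<close>
definition allocation_measure :: "'a measure \<Rightarrow> ('a \<Rightarrow> real) \<Rightarrow> ('a \<Rightarrow> real) \<Rightarrow> real measure"
  where "allocation_measure M Y S = distr (density M (\<lambda>\<omega>. ennreal (Y \<omega>))) borel S"

text \<open>
  \<^term>\<open>f\<close> is a density of \<^term>\<open>\<nu>\<close> with respect to Lebesgue measure on the positive half-line;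
  \<^term>\<open>\<nu>\<close> has no mass elsewhere, and the values of \<^term>\<open>f\<close> at nonpositive
  arguments are irrelevant. The sign condition
  excludes that \<^term>\<open>ennreal\<close> hides negative values of \<^term>\<open>f\<close>.
\<close>
definition has_density_pos :: "real measure \<Rightarrow> (real \<Rightarrow> real) \<Rightarrow> bool"
  where "has_density_pos \<nu> f \<longleftrightarrow>
    set_borel_measurable borel {0<..} f \<and>
    (AE s in lborel. 0 < s \<longrightarrow> 0 \<le> f s) \<and>
    \<nu> = density lborel (\<lambda>s. ennreal (f s) * indicator {0<..} s)"

definition expected_allocation_density ::
    "'a measure \<Rightarrow> ('a \<Rightarrow> real) \<Rightarrow> ('a \<Rightarrow> real) \<Rightarrow> (real \<Rightarrow> real) \<Rightarrow> bool"
  where "expected_allocation_density M Y S \<xi> \<longleftrightarrow> has_density_pos (allocation_measure M Y S) \<xi>"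

text \<open>
  The conditional expectation of the nonnegative variable \<^term>\<open>Y\<close> given \<^term>\<open>S = s\<close>, as a
  function of \<^term>\<open>s\<close>; it is determined up to null sets of the law of \<^term>\<open>S\<close>.
\<close>
definition cond_mean_given :: "'a measure \<Rightarrow> ('a \<Rightarrow> real) \<Rightarrow> ('a \<Rightarrow> real) \<Rightarrow> real \<Rightarrow> ennreal"
  where "cond_mean_given M Y S = RN_deriv (distr M borel S) (allocation_measure M Y S)"

definition A_coeff :: "nat \<Rightarrow> (nat \<Rightarrow> real) \<Rightarrow> nat \<Rightarrow> real"
  where "A_coeff n l k = (\<Prod>m\<in>{1..n} - {k}. l k / (l k - l m))"

end

theory Submission
  imports Defs
begin

text \<open>
  Given \<open>\<Theta> = \<theta>\<close>, the sum \<open>S\<close> is hypoexponential with rates \<open>\<theta> / \<lambda>\<^sub>k\<close>; its density and that of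
  \<open>B \<mapsto> E[X\<^sub>i; S \<in> B]\<close> follow from convolving an exponential density with the hypoexponential density of the
  remaining summands. The boundary terms collapse by \<open>\<Sum>\<^sub>k A\<^sub>k / \<lambda>\<^sub>k = 0\<close>, which is Lagrange interpolation of the
  identity at the nodes \<open>1 / \<lambda>\<^sub>k\<close>, evaluated at 0. Averaging over \<open>\<theta>\<close> turns \<open>exp (- \<theta> s / \<lambda>)\<close> into
  the Laplace transform of \<open>\<Theta>\<close> and \<open>\<theta> exp (- \<theta> s / \<lambda>)\<close> into minus its derivative. For equal \<open>\<lambda>\<^sub>k\<close>
  the \<open>n\<close> allocation measures coincide by exchangeability and sum to the measure with density \<open>s\<close>
  with respect to the law of \<open>S\<close>.
\<close>

section \<open>Convolutions of exponential densities\<close>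

text \<open>For distinct rates these are the partial fraction coefficients of the Laplace transform
  of a sum of independent exponentials: the product of \<open>r m / (r m + u)\<close> over
  \<open>m\<close> is the sum of \<open>hypoexp_coeff I r k * r k / (r k + u)\<close> over
  \<open>k\<close>.\<close>

definition hypoexp_coeff :: "'i set \<Rightarrow> ('i \<Rightarrow> real) \<Rightarrow> 'i \<Rightarrow> real" where
  "hypoexp_coeff I r k = (\<Prod>m\<in>I - {k}. r m / (r m - r k))"

text \<open>The density of a sum of independent exponentials with distinct rates. Only
  \<open>s < 0\<close> is cut off, as in \<open>exponential_density\<close>, so that a single
  summand gives exactly that function.\<close>

definition hypoexp_density :: "'i set \<Rightarrow> ('i \<Rightarrow> real) \<Rightarrow> real \<Rightarrow> real" where
  "hypoexp_density I r s =
    (if s < 0 then 0 else \<Sum>k\<in>I. hypoexp_coeff I r k * r k * exp (- r k * s))"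

text \<open>For independent exponentials \<open>X k\<close> with distinct rates \<open>r k\<close>,
  this is the Lebesgue density of the measure sending \<open>B\<close> to the mean of
  \<open>X i\<close> on the event that the sum lies in \<open>B\<close>.\<close>

definition hypoexp_alloc_density :: "'i set \<Rightarrow> ('i \<Rightarrow> real) \<Rightarrow> 'i \<Rightarrow> real \<Rightarrow> real" where
  "hypoexp_alloc_density I r i s =
    (if s < 0 then 0 else s * hypoexp_coeff I r i * r i * exp (- r i * s) +
      (\<Sum>k\<in>I - {i}. hypoexp_coeff I r k * (r k / (r i - r k)) * (exp (- r k * s) - exp (- r i * s))))"

lemma borel_measurable_hypoexp_density [measurable]: "hypoexp_density I r \<in> borel_measurable borel"
  unfolding hypoexp_density_def by measurable

text \<open>\<open>p\<close> and its interpolant \<open>q\<close> both have degree below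
  \<open>card I\<close> and agree at the \<open>card I\<close> distinct nodes, so they are the same
  polynomial.\<close>

lemma lagrange_interpolation:
  fixes r :: "'i \<Rightarrow> 'a :: field"
  assumes fin: "finite I" and inj: "inj_on r I" and deg: "degree p < card I"
  shows "poly p x = (\<Sum>k\<in>I. poly p (r k) * (\<Prod>m\<in>I - {k}. (x - r m) / (r k - r m)))"
proof -
  define L where "L k = (\<Prod>m\<in>I - {k}. smult (1 / (r k - r m)) [:- r m, 1:])" for k
  define q where "q = (\<Sum>k\<in>I. smult (poly p (r k)) (L k))"
  have polyL: "poly (L k) y = (\<Prod>m\<in>I - {k}. (y - r m) / (r k - r m))" for k y
    unfolding L_def poly_prod by (intro prod.cong) (auto simp: field_simps diff_divide_distrib)
  have degL: "degree (L k) \<le> card I - 1" if "k \<in> I" for k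
  proof -
    have "degree (L k) \<le> sum (degree \<circ> (\<lambda>m. smult (1 / (r k - r m)) [:- r m, 1:])) (I - {k})"
      unfolding L_def using fin by (intro degree_prod_sum_le) auto
    also have "\<dots> \<le> (\<Sum>m\<in>I - {k}. 1)"
      by (intro sum_mono) auto
    also have "\<dots> = card I - 1"
      using that fin by simp
    finally show ?thesis .
  qed
  have "poly q (r j) = poly p (r j)" if j: "j \<in> I" for j
  proof -
    have "poly (L k) (r j) = (if k = j then 1 else 0)" if k: "k \<in> I" for k
    proof (cases "k = j")
      case True
      have "(r j - r m) / (r k - r m) = 1" if "m \<in> I - {k}" for m
        using that True j inj by (auto dest: inj_onD)
      then show ?thesis unfolding polyL using True by simp
    next
      case False
      then show ?thesis unfolding polyL using fin j by (auto intro!: bexI[of _ j])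
    qed
    then have "poly q (r j) = (\<Sum>k\<in>I. poly p (r k) * (if k = j then 1 else 0))"
      unfolding q_def poly_sum by (intro sum.cong) auto
    then show ?thesis using j fin by (simp add: if_distrib cong: if_cong)
  qed
  moreover have "degree q \<le> card I - 1"
    unfolding q_def using degL fin
    by (intro degree_sum_le) (auto intro: order.trans[OF degree_smult_le])
  then have "degree q < card I"
    using deg by linarith
  ultimately have "q = p"
    using deg by (intro poly_eqI_degree[where A = "r ` I"]) (auto simp: card_image[OF inj])
  then have "poly p x = poly q x" by simp
  then show ?thesis
    unfolding q_def poly_sum by (simp add: polyL)
qed

text \<open>This says that the density of two or more summands vanishes at 0. It is the
  interpolation of \<open>[:0, 1:]\<close> at 0, and degree 1 calls for at least two nodes.\<close>

lemma sum_hypoexp_coeff_rate: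
  assumes "finite I" "inj_on r I" "2 \<le> card I"
  shows "(\<Sum>k\<in>I. hypoexp_coeff I r k * r k) = 0"
proof -
  have "0 = (\<Sum>k\<in>I. r k * (\<Prod>m\<in>I - {k}. (0 - r m) / (r k - r m)))"
    using lagrange_interpolation[of I r "[:0, 1:]" 0] assms by simp
  also have "\<dots> = (\<Sum>k\<in>I. hypoexp_coeff I r k * r k)"
    unfolding hypoexp_coeff_def
    by (intro sum.cong refl) (simp add: mult.commute, intro disjI2 prod.cong refl, simp add: minus_divide_left[symmetric] minus_divide_right)
  finally show ?thesis by simp
qed

lemma hypoexp_coeff_insert:
  assumes "finite J" "i \<notin> J" "k \<in> J"
  shows "hypoexp_coeff (insert i J) r k = hypoexp_coeff J r k * (r i / (r i - r k))"
proof -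
  have "insert i J - {k} = insert i (J - {k})" using assms by auto
  then show ?thesis using assms unfolding hypoexp_coeff_def by simp
qed

text \<open>A convolution integrand \<open>g\<close> is only piecewise smooth; on
  \<open>{0..s}\<close> it is replaced by a closed form \<open>f\<close> with antiderivative
  \<open>F\<close>. The second conclusion shows that \<open>ennreal\<close> truncates nothing, and
  it carries nonnegativity through the induction on the number of summands.\<close>

lemma nn_integral_FTC_Icc_support:
  fixes F f :: "real \<Rightarrow> real"
  assumes s: "0 \<le> s" and meas: "f \<in> borel_measurable borel"
    and eq: "\<And>x. x \<in> {0..s} \<Longrightarrow> g x = f x"
    and supp: "\<And>x. x \<notin> {0..s} \<Longrightarrow> g x = 0"
    and nn: "\<And>x. x \<in> {0..s} \<Longrightarrow> 0 \<le> f x"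
    and der: "\<And>x. x \<in> {0..s} \<Longrightarrow> (F has_real_derivative f x) (at x)"
  shows "(\<integral>\<^sup>+x. ennreal (g x) \<partial>lborel) = ennreal (F s - F 0)" "0 \<le> F s - F 0"
proof -
  have "(\<integral>\<^sup>+x. ennreal (g x) \<partial>lborel) = (\<integral>\<^sup>+x. ennreal (f x) * indicator {0..s} x \<partial>lborel)"
    using eq supp by (intro nn_integral_cong) (auto split: split_indicator)
  also have "\<dots> = ennreal (F s - F 0)"
    using s meas nn der by (intro nn_integral_FTC_Icc) (auto intro: DERIV_subset)
  finally show "(\<integral>\<^sup>+x. ennreal (g x) \<partial>lborel) = ennreal (F s - F 0)" .
  show "0 \<le> F s - F 0"
    using DERIV_nonneg_imp_nondecreasing[of 0 s F] s nn der by fastforce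
qed

section \<open>Adding one exponential summand with a new rate\<close>

context
  fixes J :: "'i set" and i :: 'i and r :: "'i \<Rightarrow> real"
  assumes fin: "finite J" and ne: "J \<noteq> {}" and i: "i \<notin> J"
    and inj: "inj_on r (insert i J)" and pos: "\<And>k. k \<in> insert i J \<Longrightarrow> 0 < r k"
    and nonneg: "\<And>s. 0 \<le> hypoexp_density J r s"
begin

lemma hypoexp_rate_neq: "k \<in> J \<Longrightarrow> r i \<noteq> r k"
  using inj i by (auto simp: inj_on_def)

text \<open>Convolution produces the differences \<open>exp (- r k * s) - exp (- r i * s)\<close>,
  so the coefficient of the new exponential first appears as minus a sum over \<open>J\<close>. This
  identifies it with the product formula.\<close>

lemma hypoexp_coeff_insert_new_rate: "hypoexp_coeff (insert i J) r i * r i = - (\<Sum>k\<in>J. hypoexp_coeff (insert i J) r k * r k)"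
proof -
  have "2 \<le> card (insert i J)"
    using fin ne i by (simp add: Suc_le_eq card_gt_0_iff)
  from sum_hypoexp_coeff_rate[OF _ inj this] show ?thesis
    using fin i by simp
qed

text \<open>On \<open>{0..s}\<close> the integrand is a combination of exponentials in
  \<open>x\<close> and is integrated term by term. Nonnegativity of the new density comes with it,
  since the integrand is nonnegative.\<close>

lemma hypoexp_convolution:
  shows "(\<integral>\<^sup>+x. ennreal (exponential_density (r i) x * hypoexp_density J r (s - x)) \<partial>lborel) =
      ennreal (hypoexp_density (insert i J) r s)" (is ?A)
    and "0 \<le> hypoexp_density (insert i J) r s" (is ?B)
proof -
  \<comment> \<open>The exponent has slope \<open>r k - r i\<close> in \<open>x\<close>, which is
    nonzero because the rates are distinct; dividing by it gives the antiderivative \<open>F\<close>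
    of \<open>f\<close>.\<close>
  define F where "F x = (\<Sum>k\<in>J. hypoexp_coeff J r k * r k * r i / (r k - r i) * exp (- r k * (s - x) - r i * x))" for x
  define f where "f x = (\<Sum>k\<in>J. hypoexp_coeff J r k * r k * r i * exp (- r k * (s - x) - r i * x))" for x
  have "?A \<and> ?B"
  proof (cases "s < 0")
    case True
    then have zero: "exponential_density (r i) x * hypoexp_density J r (s - x) = 0" for x
      by (auto simp: erlang_density_def hypoexp_density_def)
    show ?thesis unfolding zero using True by (simp add: hypoexp_density_def)
  next
    case False
    then have s: "0 \<le> s" by simp
    have exp_split: "exp (- r k * (s - x) - r i * x) = exp (- r k * (s - x)) * exp (- x * r i)" for k x
      by (simp flip: exp_add)
    have eq: "exponential_density (r i) x * hypoexp_density J r (s - x) = f x" if "x \<in> {0..s}" for x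
      using that unfolding f_def hypoexp_density_def exponential_density_def exp_split
      by (simp add: sum_distrib_left ac_simps)
    have supp: "exponential_density (r i) x * hypoexp_density J r (s - x) = 0" if "x \<notin> {0..s}" for x
      using that unfolding hypoexp_density_def exponential_density_def by auto
    have nn: "0 \<le> f x" if "x \<in> {0..s}" for x
      unfolding eq[OF that, symmetric] using pos[of i] nonneg by (intro mult_nonneg_nonneg) auto
    have der: "(F has_real_derivative f x) (at x)" for x
    proof -
      have "((\<lambda>x. hypoexp_coeff J r k * r k * r i / (r k - r i) * exp (- r k * (s - x) - r i * x))
          has_real_derivative (hypoexp_coeff J r k * r k * r i * exp (- r k * (s - x) - r i * x))) (at x)" if "k \<in> J" for k
      proof -
        define d where "d = r k - r i"
        define c where "c = hypoexp_coeff J r k * r k * r i"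
        have d: "d \<noteq> 0" using hypoexp_rate_neq[OF that] by (simp add: d_def)
        have "((\<lambda>x. c / d * exp (d * x - r k * s)) has_real_derivative c * exp (d * x - r k * s)) (at x)"
          using d by (auto intro!: derivative_eq_intros)
        moreover have "d * x - r k * s = - r k * (s - x) - r i * x" for x
          by (simp add: d_def algebra_simps)
        ultimately show ?thesis by (simp add: d_def c_def)
      qed
      then show ?thesis unfolding F_def f_def by (intro DERIV_sum) auto
    qed
    \<comment> \<open>The exponent is \<open>- r i * s\<close> at \<open>x = s\<close> and
      \<open>- r k * s\<close> at \<open>x = 0\<close>. The factor \<open>r i / (r i - r k)\<close>
      turns the coefficient for \<open>J\<close> into the one for \<open>insert i J\<close>.\<close>
    have "F s - F 0 = (\<Sum>k\<in>J. hypoexp_coeff (insert i J) r k * r k * (exp (- r k * s) - exp (- r i * s)))"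
      unfolding F_def sum_subtractf[symmetric]
    proof (intro sum.cong refl, goal_cases)
      case (1 k)
      define d where "d = r i - r k"
      define c where "c = hypoexp_coeff J r k"
      have d: "d \<noteq> 0" using hypoexp_rate_neq[OF 1] by (simp add: d_def)
      have "r k - r i = - d" by (simp add: d_def)
      then show ?case using d fin i 1
        by (simp add: hypoexp_coeff_insert flip: d_def c_def) (simp add: field_simps)
    qed
    also have "\<dots> = hypoexp_density (insert i J) r s"
      using s fin i hypoexp_coeff_insert_new_rate unfolding hypoexp_density_def
      by (simp add: right_diff_distrib sum_subtractf flip: sum_distrib_right)
    finally have F: "F s - F 0 = hypoexp_density (insert i J) r s" .
    have [measurable]: "f \<in> borel_measurable borel" unfolding f_def by measurable
    show ?thesis
      using nn_integral_FTC_Icc_support[OF s _ eq supp nn der] by (simp add: F)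
  qed
  then show ?A ?B by auto
qed

text \<open>The same computation with the weight \<open>x\<close>, the value of the
  \<open>i\<close>-th summand, under the integral; one integration by parts is added.\<close>

lemma hypoexp_alloc_convolution:
  shows "(\<integral>\<^sup>+x. ennreal (x * (exponential_density (r i) x * hypoexp_density J r (s - x))) \<partial>lborel) =
      ennreal (hypoexp_alloc_density (insert i J) r i s)" (is ?A)
    and "0 \<le> hypoexp_alloc_density (insert i J) r i s" (is ?B)
proof -
  \<comment> \<open>With \<open>d = r k - r i\<close>, an antiderivative of
    \<open>x * exp (d * x)\<close> is \<open>(x / d - 1 / d\<^sup>2) * exp (d * x)\<close>.\<close>
  define F where "F x = (\<Sum>k\<in>J. hypoexp_coeff J r k * r k * r i *
      (x / (r k - r i) - 1 / (r k - r i)\<^sup>2) * exp (- r k * (s - x) - r i * x))" for x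
  define f where "f x = x * (\<Sum>k\<in>J. hypoexp_coeff J r k * r k * r i * exp (- r k * (s - x) - r i * x))" for x
  have "?A \<and> ?B"
  proof (cases "s < 0")
    case True
    then have zero: "x * (exponential_density (r i) x * hypoexp_density J r (s - x)) = 0" for x
      by (auto simp: erlang_density_def hypoexp_density_def)
    show ?thesis unfolding zero using True by (simp add: hypoexp_alloc_density_def)
  next
    case False
    then have s: "0 \<le> s" by simp
    have exp_split: "exp (- r k * (s - x) - r i * x) = exp (- r k * (s - x)) * exp (- x * r i)" for k x
      by (simp flip: exp_add)
    have eq: "x * (exponential_density (r i) x * hypoexp_density J r (s - x)) = f x" if "x \<in> {0..s}" for x
      using that unfolding f_def hypoexp_density_def exponential_density_def exp_split
      by (simp add: sum_distrib_left ac_simps)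
    have supp: "x * (exponential_density (r i) x * hypoexp_density J r (s - x)) = 0" if "x \<notin> {0..s}" for x
      using that unfolding hypoexp_density_def exponential_density_def by auto
    have nn: "0 \<le> f x" if "x \<in> {0..s}" for x
      unfolding eq[OF that, symmetric] using pos[of i] nonneg that by (intro mult_nonneg_nonneg) auto
    have der: "(F has_real_derivative f x) (at x)" for x
    proof -
      have "((\<lambda>x. hypoexp_coeff J r k * r k * r i * (x / (r k - r i) - 1 / (r k - r i)\<^sup>2) * exp (- r k * (s - x) - r i * x))
          has_real_derivative (x * (hypoexp_coeff J r k * r k * r i * exp (- r k * (s - x) - r i * x)))) (at x)" if "k \<in> J" for k
      proof -
        define d where "d = r k - r i"
        define c where "c = hypoexp_coeff J r k * r k * r i"
        have d: "d \<noteq> 0" using hypoexp_rate_neq[OF that] by (simp add: d_def)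
        have "((\<lambda>x. c * (x / d - 1 / d\<^sup>2) * exp (d * x - r k * s)) has_real_derivative x * (c * exp (d * x - r k * s))) (at x)"
          using d by (auto intro!: derivative_eq_intros simp: field_simps power2_eq_square)
        moreover have "d * x - r k * s = - r k * (s - x) - r i * x" for x
          by (simp add: d_def algebra_simps)
        ultimately show ?thesis by (simp add: d_def c_def)
      qed
      then show ?thesis unfolding F_def f_def sum_distrib_left by (intro DERIV_sum) auto
    qed
    \<comment> \<open>The terms with \<open>1 / d\<^sup>2\<close> give the exponential differences.
      The term \<open>x / d\<close> survives only at \<open>x = s\<close> and gives multiples of
      \<open>s * exp (- r i * s)\<close>, which the rate identity collects into the first summand of
      the target.\<close>
    have "F s - F 0 = (\<Sum>k\<in>J. hypoexp_coeff (insert i J) r k * (r k / (r i - r k)) * (exp (- r k * s) - exp (- r i * s))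
        - hypoexp_coeff (insert i J) r k * r k * (s * exp (- r i * s)))"
      unfolding F_def sum_subtractf[symmetric]
    proof (intro sum.cong refl, goal_cases)
      case (1 k)
      define d where "d = r i - r k"
      define c where "c = hypoexp_coeff J r k"
      have d: "d \<noteq> 0" using hypoexp_rate_neq[OF 1] by (simp add: d_def)
      have "r k - r i = - d" by (simp add: d_def)
      then show ?case using d fin i 1
        by (simp add: hypoexp_coeff_insert flip: d_def c_def) (simp add: field_simps power2_eq_square)
    qed
    also have "\<dots> = hypoexp_alloc_density (insert i J) r i s"
    proof -
      have "insert i J - {i} = J" using i by auto
      moreover have "s * hypoexp_coeff (insert i J) r i * r i * exp (- r i * s)
          = (hypoexp_coeff (insert i J) r i * r i) * (s * exp (- r i * s))" by simp
      ultimately show ?thesis using s unfolding hypoexp_alloc_density_def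
        by (simp add: hypoexp_coeff_insert_new_rate sum_subtractf flip: sum_distrib_right)
    qed
    finally have F: "F s - F 0 = hypoexp_alloc_density (insert i J) r i s" .
    have [measurable]: "f \<in> borel_measurable borel" unfolding f_def by measurable
    show ?thesis
      using nn_integral_FTC_Icc_support[OF s _ eq supp nn der] by (simp add: F)
  qed
  then show ?A ?B by auto
qed

end

lemma hypoexp_density_singleton: "hypoexp_density {i} r = exponential_density (r i)"
  by (auto simp: hypoexp_density_def exponential_density_def hypoexp_coeff_def mult.commute)

lemma hypoexp_alloc_density_singleton:
  "hypoexp_alloc_density {i} r i s = s * exponential_density (r i) s"
  by (auto simp: hypoexp_alloc_density_def exponential_density_def hypoexp_coeff_def mult.commute)

text \<open>The coefficients have mixed signs, so this cannot be seen termwise; it follows by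
  induction because each step convolves nonnegative densities.\<close>

lemma hypoexp_density_nonneg:
  assumes "finite I" "I \<noteq> {}" "inj_on r I" "\<And>k. k \<in> I \<Longrightarrow> 0 < r k"
  shows "0 \<le> hypoexp_density I r s"
  using assms
proof (induction I arbitrary: s rule: finite_ne_induct)
  case (singleton i)
  then show ?case by (simp add: hypoexp_density_singleton less_imp_le)
next
  case (insert i J)
  then show ?case by (intro hypoexp_convolution(2)) auto
qed

text \<open>The index \<open>i\<close> is split off as the last summand. A single index leaves
  nothing to convolve with and is read off directly.\<close>

lemma hypoexp_alloc_density_nonneg:
  assumes "finite I" "i \<in> I" "inj_on r I" "\<And>k. k \<in> I \<Longrightarrow> 0 < r k"
  shows "0 \<le> hypoexp_alloc_density I r i s"
proof (cases "I = {i}")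
  case True
  then show ?thesis
    using assms by (cases "s < 0") (auto simp: hypoexp_alloc_density_def hypoexp_coeff_def less_imp_le)
next
  case False
  define J where "J = I - {i}"
  have J: "I = insert i J" "J \<noteq> {}" "i \<notin> J" using assms False by (auto simp: J_def)
  show ?thesis using assms unfolding J(1)
    by (intro hypoexp_alloc_convolution(2) J hypoexp_density_nonneg) auto
qed

section \<open>Sums of independent exponential variables\<close>

text \<open>Substitute \<open>y = s - x\<close> in the joint density and apply Tonelli. The weight
  \<open>w = 1\<close> yields the law of the sum, the weight \<open>w = ennreal\<close> the
  allocation measure of \<open>X\<close>.\<close>

lemma (in prob_space) indep_sum_nn_integral:
  fixes X Y :: "'a \<Rightarrow> real" and f g w \<phi> :: "real \<Rightarrow> ennreal"
  assumes indep: "indep_var borel X borel Y"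
    and X: "distributed M lborel X f" and Y: "distributed M lborel Y g"
    and [measurable]: "w \<in> borel_measurable borel" "\<phi> \<in> borel_measurable borel"
  shows "(\<integral>\<^sup>+\<omega>. w (X \<omega>) * \<phi> (X \<omega> + Y \<omega>) \<partial>M) =
    (\<integral>\<^sup>+s. (\<integral>\<^sup>+x. w x * (f x * g (s - x)) \<partial>lborel) * \<phi> s \<partial>lborel)"
proof -
  have [measurable]: "f \<in> borel_measurable borel" "g \<in> borel_measurable borel"
    using distributed_borel_measurable[OF X] distributed_borel_measurable[OF Y] by simp_all
  have "indep_var lborel X lborel Y"
    using indep by (simp add: indep_var_def indep_vars_def2 case_bool_if cong: measurable_cong_sets)
  then have "distributed M (lborel \<Otimes>\<^sub>M lborel) (\<lambda>\<omega>. (X \<omega>, Y \<omega>)) (\<lambda>(x, y). f x * g y)"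
    by (intro distributed_joint_indep X Y sigma_finite_lborel)
  from distributed_nn_integral[OF this, of "\<lambda>(x, y). w x * \<phi> (x + y)"]
  have "(\<integral>\<^sup>+\<omega>. w (X \<omega>) * \<phi> (X \<omega> + Y \<omega>) \<partial>M) =
      (\<integral>\<^sup>+z. (\<lambda>(x, y). f x * g y * (w x * \<phi> (x + y))) z \<partial>(lborel \<Otimes>\<^sub>M lborel))"
    by (simp add: split_beta')
  also have "\<dots> = (\<integral>\<^sup>+x. \<integral>\<^sup>+y. f x * g y * (w x * \<phi> (x + y)) \<partial>lborel \<partial>lborel)"
    by (subst lborel.nn_integral_fst[symmetric]) simp_all
  also have "\<dots> = (\<integral>\<^sup>+x. \<integral>\<^sup>+s. w x * (f x * g (s - x)) * \<phi> s \<partial>lborel \<partial>lborel)"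
  proof (rule nn_integral_cong)
    fix x
    have "(\<integral>\<^sup>+y. f x * g y * (w x * \<phi> (x + y)) \<partial>lborel) =
        (\<integral>\<^sup>+s. f x * g (- x + 1 * s) * (w x * \<phi> (x + (- x + 1 * s))) \<partial>lborel)"
      \<comment> \<open>Translation invariance of Lebesgue measure, written as the affine map with
        slope 1 and offset \<open>- x\<close>.\<close>
      by (subst nn_integral_real_affine[where c = 1 and t = "- x"]) simp_all
    then show "(\<integral>\<^sup>+y. f x * g y * (w x * \<phi> (x + y)) \<partial>lborel) =
        (\<integral>\<^sup>+s. w x * (f x * g (s - x)) * \<phi> s \<partial>lborel)"
      by (simp add: ac_simps)
  qed
  also have "\<dots> = (\<integral>\<^sup>+s. \<integral>\<^sup>+x. w x * (f x * g (s - x)) * \<phi> s \<partial>lborel \<partial>lborel)"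
    by (intro lborel_pair.Fubini'[symmetric]) simp
  also have "\<dots> = (\<integral>\<^sup>+s. (\<integral>\<^sup>+x. w x * (f x * g (s - x)) \<partial>lborel) * \<phi> s \<partial>lborel)"
    by (intro nn_integral_cong nn_integral_multc) simp
  finally show ?thesis .
qed

lemma (in prob_space) distributed_hypoexp:
  assumes "finite I" "I \<noteq> {}" "inj_on r I" "\<And>k. k \<in> I \<Longrightarrow> 0 < r k"
    and "\<And>k. k \<in> I \<Longrightarrow> distributed M lborel (X k) (exponential_density (r k))"
    and "indep_vars (\<lambda>_. borel) X I"
  shows "distributed M lborel (\<lambda>\<omega>. \<Sum>k\<in>I. X k \<omega>) (hypoexp_density I r)"
  using assms
proof (induction I rule: finite_ne_induct)
  case (singleton i)
  then show ?case by (simp add: hypoexp_density_singleton)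
next
  case (insert i J)
  let ?Y = "\<lambda>\<omega>. \<Sum>k\<in>J. X k \<omega>"
  have Y: "distributed M lborel ?Y (hypoexp_density J r)"
    using insert by (intro insert.IH indep_vars_subset[OF insert.prems(4)]) auto
  have X: "distributed M lborel (X i) (exponential_density (r i))"
    using insert by simp
  have ind: "indep_var borel (X i) borel ?Y"
    using insert by (intro indep_vars_sum) auto
  have [measurable]: "X i \<in> borel_measurable M" "?Y \<in> borel_measurable M"
    using distributed_measurable[OF X] distributed_measurable[OF Y] by simp_all
  have conv: "(\<integral>\<^sup>+x. ennreal (exponential_density (r i) x) * ennreal (hypoexp_density J r (s - x)) \<partial>lborel) =
      ennreal (hypoexp_density (insert i J) r s)" for s
    using insert hypoexp_density_nonneg[of J r] insert.prems(2)[of i]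
    by (subst hypoexp_convolution(1)[symmetric]) (auto simp: ennreal_mult less_imp_le)
  have "distr M lborel (\<lambda>\<omega>. X i \<omega> + ?Y \<omega>) = density lborel (hypoexp_density (insert i J) r)"
  proof (rule measure_eqI)
    fix B assume "B \<in> sets (distr M lborel (\<lambda>\<omega>. X i \<omega> + ?Y \<omega>))"
    then have [measurable]: "B \<in> sets borel" by simp
    \<comment> \<open>The factor 1 is the weight \<open>w\<close> of
      \<open>indep_sum_nn_integral\<close>.\<close>
    have "emeasure (distr M lborel (\<lambda>\<omega>. X i \<omega> + ?Y \<omega>)) B = (\<integral>\<^sup>+\<omega>. 1 * indicator B (X i \<omega> + ?Y \<omega>) \<partial>M)"
      by (simp add: nn_integral_distr flip: nn_integral_indicator)
    also have "\<dots> = emeasure (density lborel (hypoexp_density (insert i J) r)) B"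
      by (subst indep_sum_nn_integral[OF ind X Y]) (simp_all add: conv emeasure_density)
    finally show "emeasure (distr M lborel (\<lambda>\<omega>. X i \<omega> + ?Y \<omega>)) B = \<dots>" .
  qed simp
  moreover have "(\<Sum>k\<in>insert i J. X k \<omega>) = X i \<omega> + ?Y \<omega>" for \<omega>
    using insert by simp
  ultimately show ?case
    unfolding distributed_def by simp
qed

text \<open>The summands other than \<open>X i\<close> are merged into one independent variable with
  a hypoexponential law, so that the weighted two-variable convolution applies.\<close>

lemma (in prob_space) nn_integral_hypoexp_alloc:
  assumes I: "finite I" "i \<in> I" "inj_on r I" and pos: "\<And>k. k \<in> I \<Longrightarrow> 0 < r k"
    and X: "\<And>k. k \<in> I \<Longrightarrow> distributed M lborel (X k) (exponential_density (r k))"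
    and ind: "indep_vars (\<lambda>_. borel) X I"
    and [measurable]: "\<phi> \<in> borel_measurable borel"
  shows "(\<integral>\<^sup>+\<omega>. ennreal (X i \<omega>) * \<phi> (\<Sum>k\<in>I. X k \<omega>) \<partial>M) =
    (\<integral>\<^sup>+s. ennreal (hypoexp_alloc_density I r i s) * \<phi> s \<partial>lborel)"
proof (cases "I = {i}")
  case True
  have "(\<integral>\<^sup>+\<omega>. ennreal (X i \<omega>) * \<phi> (X i \<omega>) \<partial>M) =
      (\<integral>\<^sup>+s. ennreal (exponential_density (r i) s) * (ennreal s * \<phi> s) \<partial>lborel)"
    using I by (subst distributed_nn_integral[OF X]) simp_all
  also have "\<dots> = (\<integral>\<^sup>+s. ennreal (hypoexp_alloc_density {i} r i s) * \<phi> s \<partial>lborel)"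
  proof (intro nn_integral_cong)
    fix s
    have "ennreal (exponential_density (r i) s) * ennreal s = ennreal (hypoexp_alloc_density {i} r i s)"
      using pos[of i] I(2)
      by (cases "s < 0") (auto simp: hypoexp_alloc_density_singleton ennreal_mult erlang_density_def less_imp_le ac_simps)
    then show "ennreal (exponential_density (r i) s) * (ennreal s * \<phi> s) =
        ennreal (hypoexp_alloc_density {i} r i s) * \<phi> s"
      by (simp flip: mult.assoc)
  qed
  finally show ?thesis using True by simp
next
  case False
  define J where "J = I - {i}"
  have J: "I = insert i J" "finite J" "J \<noteq> {}" "i \<notin> J" using I False by (auto simp: J_def)
  let ?Y = "\<lambda>\<omega>. \<Sum>k\<in>J. X k \<omega>"
  have injJ: "inj_on r J" using I(3) unfolding J(1) by simp
  have nonneg: "0 \<le> hypoexp_density J r s" for s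
    using J pos injJ by (intro hypoexp_density_nonneg) auto
  have Y: "distributed M lborel ?Y (hypoexp_density J r)"
    using J pos injJ X by (intro distributed_hypoexp indep_vars_subset[OF ind]) auto
  have indY: "indep_var borel (X i) borel ?Y"
    using J ind by (intro indep_vars_sum) auto
  have conv: "(\<integral>\<^sup>+x. ennreal x * (ennreal (exponential_density (r i) x) * ennreal (hypoexp_density J r (s - x))) \<partial>lborel) =
      ennreal (hypoexp_alloc_density I r i s)" for s
  proof -
    \<comment> \<open>For negative \<open>x\<close> the exponential density is 0, so the truncation
      in \<open>ennreal x\<close> changes nothing.\<close>
    have "ennreal x * (ennreal (exponential_density (r i) x) * ennreal (hypoexp_density J r (s - x))) =
        ennreal (x * (exponential_density (r i) x * hypoexp_density J r (s - x)))" for x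
      using pos[of i] I(2) nonneg[of "s - x"]
      by (cases "x < 0") (auto simp: ennreal_mult erlang_density_def less_imp_le)
    then show ?thesis
      using hypoexp_alloc_convolution(1)[of J i r s] J I pos nonneg by simp
  qed
  have "(\<Sum>k\<in>I. X k \<omega>) = X i \<omega> + ?Y \<omega>" for \<omega>
    using J by simp
  then show ?thesis
    using indep_sum_nn_integral[OF indY X[OF I(2)] Y, of ennreal \<phi>] by (simp add: conv)
qed

text \<open>Exchangeability without permuting coordinates: whichever index is removed, the remaining
  sum has the same Erlang law, and the convolution formula no longer mentions the index.\<close>

lemma (in prob_space) nn_integral_iid_exponential_alloc_cong:
  assumes I: "finite I" "i \<in> I" "j \<in> I" and pos: "0 < r"
    and X: "\<And>k. k \<in> I \<Longrightarrow> distributed M lborel (X k) (exponential_density r)"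
    and ind: "indep_vars (\<lambda>_. borel) X I"
    and [measurable]: "\<phi> \<in> borel_measurable borel"
  shows "(\<integral>\<^sup>+\<omega>. ennreal (X i \<omega>) * \<phi> (\<Sum>k\<in>I. X k \<omega>) \<partial>M) =
    (\<integral>\<^sup>+\<omega>. ennreal (X j \<omega>) * \<phi> (\<Sum>k\<in>I. X k \<omega>) \<partial>M)"
proof (cases "card I = 1")
  case True
  then show ?thesis using I by (auto simp: card_1_singleton_iff)
next
  case False
  \<comment> \<open>\<open>erlang_density k\<close> belongs to a sum of \<open>k + 1\<close>
    exponentials and \<open>card I - 1\<close> summands remain, hence \<open>card I - 2\<close>. The
    case of one index is set apart because then no summand remains.\<close>
  have "(\<integral>\<^sup>+\<omega>. ennreal (X i \<omega>) * \<phi> (\<Sum>k\<in>I. X k \<omega>) \<partial>M) =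
      (\<integral>\<^sup>+s. (\<integral>\<^sup>+x. ennreal x * (exponential_density r x * erlang_density (card I - 2) r (s - x)) \<partial>lborel) * \<phi> s \<partial>lborel)"
    if i: "i \<in> I" for i
  proof -
    define J where "J = I - {i}"
    have J: "I = insert i J" "finite J" "i \<notin> J" using I i by (auto simp: J_def)
    have "J \<noteq> {}" using False J by auto
    let ?Y = "\<lambda>\<omega>. \<Sum>k\<in>J. X k \<omega>"
    have Y: "distributed M lborel ?Y (erlang_density (card J - 1) r)"
      using J \<open>J \<noteq> {}\<close> pos X by (intro exponential_distributed_sum indep_vars_subset[OF ind]) auto
    have indY: "indep_var borel (X i) borel ?Y"
      using J ind by (intro indep_vars_sum) auto
    have "card J - 1 = card I - 2" using J by simp
    moreover have "(\<Sum>k\<in>I. X k \<omega>) = X i \<omega> + ?Y \<omega>" for \<omega>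
      using J by simp
    ultimately show ?thesis
      using indep_sum_nn_integral[OF indY X[OF i] Y, of ennreal \<phi>] pos by (simp add: ennreal_mult)
  qed
  then show ?thesis using I by simp
qed

section \<open>Mixtures and Laplace transforms\<close>

text \<open>Taking \<open>A = space L\<close> in the disintegration shows that the law of
  \<open>Z\<close> is the kernel averaged over the law of \<open>Y\<close>.\<close>

lemma regular_cond_distr_bind:
  assumes "prob_space M" and K: "regular_cond_distr M N Z L Y K"
  shows "distr M N Z = distr M L Y \<bind> K"
proof -
  interpret prob_space M by fact
  have [measurable]: "Z \<in> M \<rightarrow>\<^sub>M N" "Y \<in> M \<rightarrow>\<^sub>M L" "K \<in> L \<rightarrow>\<^sub>M prob_algebra N"
    and disint: "\<And>A B. A \<in> sets L \<Longrightarrow> B \<in> sets N \<Longrightarrow>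
       emeasure M {\<omega> \<in> space M. Y \<omega> \<in> A \<and> Z \<omega> \<in> B} = (\<integral>\<^sup>+y\<in>A. emeasure (K y) B \<partial>distr M L Y)"
    using K by (auto simp: regular_cond_distr_def)
  have P: "distr M L Y \<in> space (prob_algebra L)"
    by (simp add: space_prob_algebra prob_space_distr)
  show ?thesis
  proof (rule measure_eqI)
    show "sets (distr M N Z) = sets (distr M L Y \<bind> K)"
      by (simp add: sets_bind'[OF P \<open>K \<in> L \<rightarrow>\<^sub>M prob_algebra N\<close>])
    fix B assume "B \<in> sets (distr M N Z)"
    then have B: "B \<in> sets N" by simp
    have "emeasure (distr M N Z) B = emeasure M {\<omega> \<in> space M. Y \<omega> \<in> space L \<and> Z \<omega> \<in> B}"
      using B measurable_space[OF \<open>Y \<in> M \<rightarrow>\<^sub>M L\<close>]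
      by (auto simp: emeasure_distr intro!: arg_cong[where f = "emeasure M"])
    also have "\<dots> = (\<integral>\<^sup>+y. emeasure (K y) B \<partial>distr M L Y)"
      using B by (subst disint) (auto intro!: nn_integral_cong)
    also have "\<dots> = emeasure (distr M L Y \<bind> K) B"
      by (rule emeasure_bind_prob_algebra[OF P \<open>K \<in> L \<rightarrow>\<^sub>M prob_algebra N\<close> B, symmetric])
    finally show "emeasure (distr M N Z) B = emeasure (distr M L Y \<bind> K) B" .
  qed
qed

text \<open>This lets computations for a fixed value of the mixing variable run under an outer
  integral over \<open>M\<close>. Nonnegative integrals keep it valid for infinite means.\<close>

lemma regular_cond_distr_nn_integral:
  assumes M: "prob_space M" and K: "regular_cond_distr M N Z L Y K" and f: "f \<in> borel_measurable N"
  shows "(\<integral>\<^sup>+\<omega>. f (Z \<omega>) \<partial>M) = (\<integral>\<^sup>+\<omega>. \<integral>\<^sup>+z. f z \<partial>K (Y \<omega>) \<partial>M)"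
proof -
  have [measurable]: "Z \<in> M \<rightarrow>\<^sub>M N" "Y \<in> M \<rightarrow>\<^sub>M L" and K': "K \<in> L \<rightarrow>\<^sub>M subprob_algebra N"
    using K by (auto simp: regular_cond_distr_def intro: measurable_prob_algebraD)
  note [measurable] = f
  have "(\<integral>\<^sup>+\<omega>. f (Z \<omega>) \<partial>M) = (\<integral>\<^sup>+z. f z \<partial>(distr M L Y \<bind> K))"
    by (simp add: nn_integral_distr flip: regular_cond_distr_bind[OF M K])
  also have "\<dots> = (\<integral>\<^sup>+y. \<integral>\<^sup>+z. f z \<partial>K y \<partial>distr M L Y)"
    using K' by (intro nn_integral_bind) auto
  also have "\<dots> = (\<integral>\<^sup>+\<omega>. \<integral>\<^sup>+z. f z \<partial>K (Y \<omega>) \<partial>M)"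
    by (intro nn_integral_distr) (auto intro: measurable_compose[OF K' nn_integral_measurable_subprob_algebra[OF f]])
  finally show ?thesis .
qed

text \<open>Integrate the indicator of the exceptional set: its conditional integrals vanish almost
  surely, hence so does its mean.\<close>

lemma regular_cond_distr_AE:
  assumes M: "prob_space M" and K: "regular_cond_distr M N Z L Y K" and P: "Measurable.pred N P"
    and AE: "AE \<omega> in M. AE z in K (Y \<omega>). P z"
  shows "AE \<omega> in M. P (Z \<omega>)"
proof -
  have [measurable]: "Z \<in> M \<rightarrow>\<^sub>M N" "Y \<in> M \<rightarrow>\<^sub>M L" and K': "K \<in> L \<rightarrow>\<^sub>M prob_algebra N"
    using K by (auto simp: regular_cond_distr_def)
  have sets: "sets (K (Y \<omega>)) = sets N" if "\<omega> \<in> space M" for \<omega>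
    using that measurable_space[OF K'] measurable_space[OF \<open>Y \<in> M \<rightarrow>\<^sub>M L\<close>] by (auto simp: space_prob_algebra)
  note [measurable] = P
  have "(\<integral>\<^sup>+\<omega>. indicator {z \<in> space N. \<not> P z} (Z \<omega>) \<partial>M) =
      (\<integral>\<^sup>+\<omega>. \<integral>\<^sup>+z. indicator {z \<in> space N. \<not> P z} z \<partial>K (Y \<omega>) \<partial>M)"
    by (intro regular_cond_distr_nn_integral[OF M K]) measurable
  also have "\<dots> = (\<integral>\<^sup>+\<omega>. 0 \<partial>M)"
  proof (rule nn_integral_cong_AE, use AE in eventually_elim)
    case (elim \<omega>)
    have "(\<integral>\<^sup>+z. indicator {z \<in> space N. \<not> P z} z \<partial>K (Y \<omega>)) = (\<integral>\<^sup>+z. 0 \<partial>K (Y \<omega>))"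
      by (rule nn_integral_cong_AE, use elim in eventually_elim) auto
    then show ?case by simp
  qed
  finally have "(\<integral>\<^sup>+\<omega>. indicator {z \<in> space N. \<not> P z} (Z \<omega>) \<partial>M) = 0"
    by simp
  then have "AE \<omega> in M. indicator {z \<in> space N. \<not> P z} (Z \<omega>) = (0 :: ennreal)"
    by (subst (asm) nn_integral_0_iff_AE) simp_all
  then show ?thesis
    using AE_space
    by eventually_elim (use measurable_space[OF \<open>Z \<in> M \<rightarrow>\<^sub>M N\<close>] in \<open>auto split: split_indicator_asm\<close>)
qed

text \<open>Tonelli exchanges the average over the mixing variable with Lebesgue integration in
  \<open>s\<close>; the inner average is then \<open>f s\<close>. Integrability is asked for at each
  \<open>s > 0\<close> separately, since at \<open>s = 0\<close> the mean of \<open>T\<close> may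
  appear, which can be infinite.\<close>

lemma has_density_pos_mixture:
  fixes g :: "real \<Rightarrow> real \<Rightarrow> real" and f :: "real \<Rightarrow> real"
  assumes M: "prob_space M" and [measurable]: "T \<in> borel_measurable M"
    and g [measurable]: "(\<lambda>(t, s). g t s) \<in> borel_measurable (borel \<Otimes>\<^sub>M borel)"
    and nonneg: "AE \<omega> in M. \<forall>s>0. 0 \<le> g (T \<omega>) s"
    and int: "\<And>s. 0 < s \<Longrightarrow> integrable M (\<lambda>\<omega>. g (T \<omega>) s)"
    and f: "\<And>s. 0 < s \<Longrightarrow> f s = (\<integral>\<omega>. g (T \<omega>) s \<partial>M)"
    and sets: "sets \<nu> = sets borel"
    and \<nu>: "\<And>B. B \<in> sets borel \<Longrightarrow>
        emeasure \<nu> B = (\<integral>\<^sup>+\<omega>. (\<integral>\<^sup>+s. ennreal (g (T \<omega>) s) * indicator {0<..} s * indicator B s \<partial>lborel) \<partial>M)"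
  shows "has_density_pos \<nu> f"
  unfolding has_density_pos_def
proof (intro conjI)
  interpret prob_space M by fact
  interpret pair_sigma_finite M lborel ..
  have g' [measurable]: "(\<lambda>(\<omega>, s). g (T \<omega>) s) \<in> borel_measurable (M \<Otimes>\<^sub>M borel)"
    using measurable_compose[OF _ g, of "\<lambda>(\<omega>, s). (T \<omega>, s)" "M \<Otimes>\<^sub>M borel"] by (simp add: split_beta')
  have [measurable]: "(\<lambda>s. \<integral>\<omega>. g (T \<omega>) s \<partial>M) \<in> borel_measurable borel"
    by measurable
  \<comment> \<open>\<open>f\<close> is prescribed only on the positive half-line, so measurability
    is transferred from the parametrised integral after multiplying by the indicator.\<close>
  have "set_borel_measurable borel {0<..} f \<longleftrightarrow> set_borel_measurable borel {0<..} (\<lambda>s. \<integral>\<omega>. g (T \<omega>) s \<partial>M)"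
    unfolding set_borel_measurable_def using f by (intro measurable_cong) (auto split: split_indicator)
  then show "set_borel_measurable borel {0<..} f"
    unfolding set_borel_measurable_def by simp
  have "0 \<le> f s" if "0 < s" for s
    using nonneg that unfolding f[OF that] by (intro integral_nonneg_AE) auto
  then show "AE s in lborel. 0 < s \<longrightarrow> 0 \<le> f s" by simp
  show "\<nu> = density lborel (\<lambda>s. ennreal (f s) * indicator {0<..} s)"
  proof (rule measure_eqI)
    fix B assume "B \<in> sets \<nu>"
    then have [measurable]: "B \<in> sets borel" by (simp add: sets)
    have fm: "ennreal (f s) * indicator {0<..} s = ennreal (\<integral>\<omega>. g (T \<omega>) s \<partial>M) * indicator {0<..} s" for s
      using f by (auto split: split_indicator)
    have "emeasure \<nu> B = (\<integral>\<^sup>+\<omega>. (\<integral>\<^sup>+s. ennreal (g (T \<omega>) s) * indicator {0<..} s * indicator B s \<partial>lborel) \<partial>M)"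
      by (simp add: \<nu>)
    also have "\<dots> = (\<integral>\<^sup>+s. (\<integral>\<^sup>+\<omega>. ennreal (g (T \<omega>) s) * indicator {0<..} s * indicator B s \<partial>M) \<partial>lborel)"
      by (intro Fubini'[symmetric]) measurable
    also have "\<dots> = (\<integral>\<^sup>+s. ennreal (f s) * indicator {0<..} s * indicator B s \<partial>lborel)"
    proof (rule nn_integral_cong)
      fix s :: real
      have "(\<integral>\<^sup>+\<omega>. ennreal (g (T \<omega>) s) \<partial>M) = ennreal (f s)" if "0 < s"
        using nonneg that unfolding f[OF that] by (intro nn_integral_eq_integral int) auto
      then show "(\<integral>\<^sup>+\<omega>. ennreal (g (T \<omega>) s) * indicator {0<..} s * indicator B s \<partial>M) =
          ennreal (f s) * indicator {0<..} s * indicator B s"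
        by (auto split: split_indicator)
    qed
    also have "\<dots> = emeasure (density lborel (\<lambda>s. ennreal (f s) * indicator {0<..} s)) B"
      unfolding fm by (simp add: emeasure_density)
    finally show "emeasure \<nu> B = \<dots>" .
  qed (simp add: sets)
qed

section \<open>The derivative of the Laplace transform\<close>

lemma mult_exp_minus_le:
  fixes t u :: real
  assumes "0 < u" "0 \<le> t"
  shows "t * exp (- u * t) \<le> 1 / u"
proof -
  have "u * t \<le> exp (u * t)" using exp_ge_add_one_self[of "u * t"] by linarith
  then show ?thesis using assms by (simp add: exp_minus field_simps)
qed

context
  fixes M :: "'a measure" and T :: "'a \<Rightarrow> real"
  assumes M: "prob_space M" and T: "T \<in> borel_measurable M" and pos: "AE \<omega> in M. 0 < T \<omega>"
begin

interpretation prob_space M by (rule M)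
declare T [measurable]

lemma integrable_exp_minus_mult: "0 < u \<Longrightarrow> integrable M (\<lambda>\<omega>. exp (- u * T \<omega>))"
  using pos by (intro integrable_const_bound[where B = 1]) (auto elim!: eventually_mono)

lemma integrable_mult_exp_minus_mult: "0 < u \<Longrightarrow> integrable M (\<lambda>\<omega>. T \<omega> * exp (- u * T \<omega>))"
  using pos by (intro integrable_const_bound[where B = "1 / u"])
    (auto elim!: eventually_mono simp: abs_mult mult_exp_minus_le[simplified])

text \<open>Differentiability lets the derivative be computed along one sequence of increments, and
  dominated convergence moves that limit under the expectation. The constant bound
  \<open>1 / u\<close> works even if \<open>T\<close> has infinite mean.\<close>

lemma deriv_laplace_stieltjes:
  assumes u: "0 < u" and diff: "laplace_stieltjes M T differentiable (at u)"
  shows "deriv (laplace_stieltjes M T) u = - (\<integral>\<omega>. T \<omega> * exp (- u * T \<omega>) \<partial>M)"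
proof -
  \<comment> \<open>Positive increments keep the shifted argument above \<open>u\<close>, so the
    difference quotients stay bounded; a sequence fits dominated convergence.\<close>
  define h where "h j = 1 / real (Suc j)" for j
  have h: "0 < h j" for j by (simp add: h_def)
  have h0: "h \<longlonglongrightarrow> 0" unfolding h_def by (rule LIMSEQ_Suc[OF lim_1_over_n])
  then have h_at: "filterlim h (at 0) sequentially"
    using h by (simp add: filterlim_at less_imp_neq[symmetric])
  have "(laplace_stieltjes M T has_real_derivative deriv (laplace_stieltjes M T) u) (at u)"
    using diff by (simp add: DERIV_deriv_iff_real_differentiable)
  then have lim1: "(\<lambda>j. (laplace_stieltjes M T (u + h j) - laplace_stieltjes M T u) / h j)
      \<longlonglongrightarrow> deriv (laplace_stieltjes M T) u"
    unfolding DERIV_def by (rule filterlim_compose[OF _ h_at])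
  define D where "D j \<omega> = (exp (- (u + h j) * T \<omega>) - exp (- u * T \<omega>)) / h j" for j \<omega>
  have "(laplace_stieltjes M T (u + h j) - laplace_stieltjes M T u) / h j = (\<integral>\<omega>. D j \<omega> \<partial>M)" for j
    unfolding laplace_stieltjes_def D_def
    using integrable_exp_minus_mult[of u] integrable_exp_minus_mult[of "u + h j"] u h[of j]
    by (subst integral_divide_zero, subst Bochner_Integration.integral_diff) simp_all
  moreover have "(\<lambda>j. \<integral>\<omega>. D j \<omega> \<partial>M) \<longlonglongrightarrow> (\<integral>\<omega>. - (T \<omega> * exp (- u * T \<omega>)) \<partial>M)"
  proof (rule integral_dominated_convergence[where w = "\<lambda>_. 1 / u"])
    show "AE \<omega> in M. (\<lambda>j. D j \<omega>) \<longlonglongrightarrow> - (T \<omega> * exp (- u * T \<omega>))"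
    proof (rule AE_I2)
      fix \<omega>
      have "((\<lambda>v. exp (- v * T \<omega>)) has_real_derivative - (T \<omega> * exp (- u * T \<omega>))) (at u)"
        by (auto intro!: derivative_eq_intros)
      then show "(\<lambda>j. D j \<omega>) \<longlonglongrightarrow> - (T \<omega> * exp (- u * T \<omega>))"
        unfolding DERIV_def D_def by (rule filterlim_compose[OF _ h_at])
    qed
    fix j
    show "AE \<omega> in M. norm (D j \<omega>) \<le> 1 / u"
      using pos
    proof eventually_elim
      case (elim \<omega>)
      \<comment> \<open>Factoring out \<open>exp (- u * T \<omega>)\<close> leaves
        \<open>(1 - exp (- h j * T \<omega>)) / h j\<close>, which lies between 0 and
        \<open>T \<omega>\<close>; then \<open>mult_exp_minus_le\<close> bounds the product.\<close>
      have exp_split: "exp (- (u + h j) * T \<omega>) = exp (- u * T \<omega>) * exp (- h j * T \<omega>)"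
        by (simp add: algebra_simps flip: exp_add)
      have eq: "D j \<omega> = - (exp (- u * T \<omega>) * ((1 - exp (- h j * T \<omega>)) / h j))"
        unfolding D_def exp_split by (simp add: right_diff_distrib diff_divide_distrib)
      have "1 - exp (- h j * T \<omega>) \<le> h j * T \<omega>"
        using exp_ge_add_one_self[of "- h j * T \<omega>"] by linarith
      then have le: "(1 - exp (- h j * T \<omega>)) / h j \<le> T \<omega>"
        using h[of j] by (simp add: field_simps)
      have ge: "0 \<le> (1 - exp (- h j * T \<omega>)) / h j"
        using h[of j] elim by (simp add: less_imp_le)
      have "norm (D j \<omega>) = exp (- u * T \<omega>) * ((1 - exp (- h j * T \<omega>)) / h j)"
        unfolding eq real_norm_def abs_minus_cancel
        by (rule abs_of_nonneg, rule mult_nonneg_nonneg[OF exp_ge_zero ge])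
      also have "\<dots> \<le> exp (- u * T \<omega>) * T \<omega>"
        using le by (intro mult_left_mono) auto
      also have "\<dots> \<le> 1 / u"
        using mult_exp_minus_le[OF u, of "T \<omega>"] elim by (simp add: mult.commute)
      finally show ?case .
    qed
  qed (auto simp: D_def)
  ultimately have "(\<integral>\<omega>. - (T \<omega> * exp (- u * T \<omega>)) \<partial>M) = deriv (laplace_stieltjes M T) u"
    using lim1 by (intro LIMSEQ_unique) simp_all
  then show ?thesis by simp
qed

end

section \<open>Mixed exponential risks\<close>

text \<open>The densities above live on the closed half-line, \<open>has_density_pos\<close> on the
  open one; the point 0 between them is a null set.\<close>

lemma nn_integral_lborel_pos_cong:
  fixes p q :: "real \<Rightarrow> real"
  assumes "\<And>s. s < 0 \<Longrightarrow> p s = 0" "\<And>s. 0 < s \<Longrightarrow> p s = q s"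
  shows "(\<integral>\<^sup>+s. ennreal (p s) * \<phi> s \<partial>lborel) = (\<integral>\<^sup>+s. ennreal (q s) * indicator {0<..} s * \<phi> s \<partial>lborel)"
  using AE_lborel_singleton[of "0 :: real"]
  by (intro nn_integral_cong_AE, elim eventually_mono) (use assms in \<open>auto split: split_indicator\<close>)

text \<open>The statement about the kernel is phrased almost surely over \<open>M\<close>, so that
  it combines with positivity of \<open>\<Theta>\<close> under a single outer integral.\<close>

locale exponential_mixture = prob_space M for M :: "'a measure" +
  fixes \<Theta> :: "'a \<Rightarrow> real" and X :: "nat \<Rightarrow> 'a \<Rightarrow> real" and S :: "'a \<Rightarrow> real"
    and n :: nat and l :: "nat \<Rightarrow> real" and K :: "real \<Rightarrow> (nat \<Rightarrow> real) measure"
  assumes \<Theta> [measurable]: "\<Theta> \<in> borel_measurable M" and \<Theta>_pos: "AE \<omega> in M. 0 < \<Theta> \<omega>"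
    and laplace_diff: "\<And>u. 0 < u \<Longrightarrow> laplace_stieltjes M \<Theta> differentiable (at u)"
    and n: "1 \<le> n" and l_pos: "\<And>i. i \<in> {1..n} \<Longrightarrow> 0 < l i"
    and X [measurable]: "\<And>i. i \<in> {1..n} \<Longrightarrow> X i \<in> borel_measurable M"
    and K: "regular_cond_distr M (PiM {1..n} (\<lambda>_. borel)) (\<lambda>\<omega>. \<lambda>i\<in>{1..n}. X i \<omega>) borel \<Theta> K"
    and cond: "AE \<omega> in M. prob_space.indep_vars (K (\<Theta> \<omega>)) (\<lambda>_. borel) (\<lambda>i x. x i) {1..n} \<and>
      (\<forall>i\<in>{1..n}. distributed (K (\<Theta> \<omega>)) lborel (\<lambda>x. x i) (exponential_density (\<Theta> \<omega> / l i)))"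
    and S: "S = (\<lambda>\<omega>. \<Sum>i\<in>{1..n}. X i \<omega>)"
begin

lemma measurable_S [measurable]: "S \<in> borel_measurable M"
  unfolding S by measurable

lemma prob_space_K: "prob_space (K t)"
proof -
  have "K \<in> borel \<rightarrow>\<^sub>M prob_algebra (PiM {1..n} (\<lambda>_. borel))"
    using K by (simp add: regular_cond_distr_def)
  from measurable_space[OF this, of t] show ?thesis
    by (simp add: space_prob_algebra)
qed

lemma nn_integral_S:
  assumes [measurable]: "\<phi> \<in> borel_measurable borel"
  shows "(\<integral>\<^sup>+\<omega>. \<phi> (S \<omega>) \<partial>M) = (\<integral>\<^sup>+\<omega>. \<integral>\<^sup>+x. \<phi> (\<Sum>k\<in>{1..n}. x k) \<partial>K (\<Theta> \<omega>) \<partial>M)"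
  using regular_cond_distr_nn_integral[OF prob_space_axioms K, of "\<lambda>x. \<phi> (\<Sum>k\<in>{1..n}. x k)"]
  by (simp add: S)

lemma nn_integral_alloc:
  assumes i: "i \<in> {1..n}" and [measurable]: "\<phi> \<in> borel_measurable borel"
  shows "(\<integral>\<^sup>+\<omega>. ennreal (X i \<omega>) * \<phi> (S \<omega>) \<partial>M) =
    (\<integral>\<^sup>+\<omega>. \<integral>\<^sup>+x. ennreal (x i) * \<phi> (\<Sum>k\<in>{1..n}. x k) \<partial>K (\<Theta> \<omega>) \<partial>M)"
  using regular_cond_distr_nn_integral[OF prob_space_axioms K, of "\<lambda>x. ennreal (x i) * \<phi> (\<Sum>k\<in>{1..n}. x k)"] i
  by (simp add: S)

lemma emeasure_allocation_measure:
  assumes "i \<in> {1..n}" "B \<in> sets borel"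
  shows "emeasure (allocation_measure M (X i) S) B = (\<integral>\<^sup>+\<omega>. ennreal (X i \<omega>) * indicator B (S \<omega>) \<partial>M)"
proof -
  have "indicator (S -` B \<inter> space M) \<omega> = (indicator B (S \<omega>) :: ennreal)" if "\<omega> \<in> space M" for \<omega>
    using that by (auto split: split_indicator)
  then show ?thesis
    using assms unfolding allocation_measure_def
    by (simp add: emeasure_distr emeasure_density cong: nn_integral_cong)
qed

lemma integrable_laplace_terms:
  assumes "0 < s" "k \<in> {1..n}"
  shows "integrable M (\<lambda>\<omega>. exp (- (s / l k) * \<Theta> \<omega>))"
    and "integrable M (\<lambda>\<omega>. \<Theta> \<omega> * exp (- (s / l k) * \<Theta> \<omega>))"
  using assms l_pos[of k]
  by (intro integrable_exp_minus_mult integrable_mult_exp_minus_mult prob_space_axioms \<Theta> \<Theta>_pos; simp)+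

lemma deriv_laplace:
  assumes "0 < s" "k \<in> {1..n}"
  shows "(\<integral>\<omega>. \<Theta> \<omega> * exp (- (s / l k) * \<Theta> \<omega>) \<partial>M) = - deriv (laplace_stieltjes M \<Theta>) (s / l k)"
  using assms l_pos[of k]
  by (subst deriv_laplace_stieltjes[OF prob_space_axioms \<Theta> \<Theta>_pos _ laplace_diff]) simp_all

text \<open>The common factor \<open>t\<close> cancels in every quotient, so the coefficients are
  nonrandom and can be pulled out of the average over \<open>\<Theta>\<close>.\<close>

lemma hypoexp_coeff_rates:
  assumes "0 < t" "inj_on l {1..n}" "k \<in> {1..n}"
  shows "hypoexp_coeff {1..n} (\<lambda>k. t / l k) k = A_coeff n l k"
  unfolding hypoexp_coeff_def A_coeff_def
proof (rule prod.cong)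
  fix m assume m: "m \<in> {1..n} - {k}"
  then have "l m \<noteq> l k" "0 < l m" "0 < l k"
    using assms l_pos by (auto dest: inj_onD)
  then show "t / l m / (t / l m - t / l k) = l k / (l k - l m)"
    using assms(1) by (simp add: field_simps)
qed simp

lemma has_density_sum:
  assumes inj: "inj_on l {1..n}"
  shows "has_density_pos (distr M borel S)
    (\<lambda>s. - (\<Sum>k\<in>{1..n}. A_coeff n l k / l k * deriv (laplace_stieltjes M \<Theta>) (s / l k)))"
proof -
  \<comment> \<open>The conditional density given \<open>\<Theta> = t\<close>, arranged so that
    averaging each term over \<open>t\<close> gives minus the derivative of the Laplace transform at
    \<open>s / l k\<close>.\<close>
  define g where "g t s = (\<Sum>k\<in>{1..n}. A_coeff n l k / l k * (t * exp (- (s / l k) * t)))" for t s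
  have exp_swap: "exp (- (t / l k) * s) = exp (- (s / l k) * t)" for s t k
    by (simp add: mult.commute)
  have g: "hypoexp_density {1..n} (\<lambda>k. t / l k) s = g t s" if "0 < t" "0 < s" for t s
  proof -
    have "hypoexp_coeff {1..n} (\<lambda>k. t / l k) k * (t / l k) * exp (- (t / l k) * s) =
        A_coeff n l k / l k * (t * exp (- (s / l k) * t))" if "k \<in> {1..n}" for k
      unfolding hypoexp_coeff_rates[OF \<open>0 < t\<close> inj that] exp_swap[of t k s] by simp
    then have "(\<Sum>k\<in>{1..n}. hypoexp_coeff {1..n} (\<lambda>k. t / l k) k * (t / l k) * exp (- (t / l k) * s)) = g t s"
      unfolding g_def by (rule sum.cong[OF refl])
    then show ?thesis
      using that by (simp add: hypoexp_density_def)
  qed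
  have inj': "inj_on (\<lambda>k. t / l k) {1..n}" if "0 < t" for t
  proof (rule inj_onI)
    fix x y assume xy: "x \<in> {1..n}" "y \<in> {1..n}" and "t / l x = t / l y"
    then have "l x = l y"
      using that l_pos[of x] l_pos[of y] by (simp add: divide_inverse)
    then show "x = y" by (rule inj_onD[OF inj _ xy])
  qed
  show ?thesis
  proof (rule has_density_pos_mixture[OF prob_space_axioms \<Theta>, of g])
    show "(\<lambda>(t, s). g t s) \<in> borel_measurable (borel \<Otimes>\<^sub>M borel)"
      unfolding g_def by measurable
    show "AE \<omega> in M. \<forall>s>0. 0 \<le> g (\<Theta> \<omega>) s"
      using \<Theta>_pos
    proof eventually_elim
      case (elim \<omega>)
      have "0 \<le> hypoexp_density {1..n} (\<lambda>k. \<Theta> \<omega> / l k) s" for s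
        using elim n l_pos inj' by (intro hypoexp_density_nonneg) auto
      then show ?case using g elim by metis
    qed
    show "integrable M (\<lambda>\<omega>. g (\<Theta> \<omega>) s)" if "0 < s" for s
      unfolding g_def using that integrable_laplace_terms by (intro Bochner_Integration.integrable_sum integrable_mult_right) blast
    show "- (\<Sum>k\<in>{1..n}. A_coeff n l k / l k * deriv (laplace_stieltjes M \<Theta>) (s / l k)) = (\<integral>\<omega>. g (\<Theta> \<omega>) s \<partial>M)"
      if "0 < s" for s
      unfolding g_def using that integrable_laplace_terms[OF that] deriv_laplace[OF that]
      by (subst Bochner_Integration.integral_sum) (auto simp: sum_negf[symmetric] simp del: mult_minus_left)
    fix B :: "real set" assume [measurable]: "B \<in> sets borel"
    have "emeasure (distr M borel S) B = (\<integral>\<^sup>+\<omega>. indicator B (S \<omega>) \<partial>M)"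
      by (simp add: nn_integral_distr flip: nn_integral_indicator)
    also have "\<dots> = (\<integral>\<^sup>+\<omega>. \<integral>\<^sup>+x. indicator B (\<Sum>k\<in>{1..n}. x k) \<partial>K (\<Theta> \<omega>) \<partial>M)"
      by (rule nn_integral_S) measurable
    also have "\<dots> = (\<integral>\<^sup>+\<omega>. (\<integral>\<^sup>+s. ennreal (g (\<Theta> \<omega>) s) * indicator {0<..} s * indicator B s \<partial>lborel) \<partial>M)"
    proof (rule nn_integral_cong_AE, use \<Theta>_pos cond in eventually_elim)
      case (elim \<omega>)
      interpret K: prob_space "K (\<Theta> \<omega>)" by (rule prob_space_K)
      have "distributed (K (\<Theta> \<omega>)) lborel (\<lambda>x. \<Sum>k\<in>{1..n}. x k) (hypoexp_density {1..n} (\<lambda>k. \<Theta> \<omega> / l k))"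
        using elim n l_pos inj' by (intro K.distributed_hypoexp) auto
      from distributed_nn_integral[OF this, of "indicator B"]
      have "(\<integral>\<^sup>+x. indicator B (\<Sum>k\<in>{1..n}. x k) \<partial>K (\<Theta> \<omega>)) =
          (\<integral>\<^sup>+s. ennreal (hypoexp_density {1..n} (\<lambda>k. \<Theta> \<omega> / l k) s) * indicator B s \<partial>lborel)"
        by simp
      also have "\<dots> = (\<integral>\<^sup>+s. ennreal (g (\<Theta> \<omega>) s) * indicator {0<..} s * indicator B s \<partial>lborel)"
        using elim g by (intro nn_integral_lborel_pos_cong) (auto simp: hypoexp_density_def)
      finally show ?case .
    qed
    finally show "emeasure (distr M borel S) B = \<dots>" .
  qed simp
qed

lemma expected_allocation_density_distinct:
  assumes inj: "inj_on l {1..n}" and i: "i \<in> {1..n}"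
  shows "expected_allocation_density M (X i) S
    (\<lambda>s. - (s / l i) * A_coeff n l i * deriv (laplace_stieltjes M \<Theta>) (s / l i) +
         (\<Sum>k\<in>{1..n} - {i}. A_coeff n l k * (l i / (l i - l k)) *
            (laplace_stieltjes M \<Theta> (s / l i) - laplace_stieltjes M \<Theta> (s / l k))))"
  unfolding expected_allocation_density_def
proof -
  \<comment> \<open>The conditional allocation density given \<open>\<Theta> = t\<close>: averaging
    turns the first term into a Laplace derivative and the differences into differences of Laplace
    transforms.\<close>
  define g where "g t s = s / l i * A_coeff n l i * (t * exp (- (s / l i) * t)) +
    (\<Sum>k\<in>{1..n} - {i}. A_coeff n l k * (l i / (l i - l k)) * (exp (- (s / l i) * t) - exp (- (s / l k) * t)))" for t s
  have exp_swap: "exp (- (t / l k) * s) = exp (- (s / l k) * t)" for s t k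
    by (simp add: mult.commute)
  have flip: "a * - q * (x - y) = a * q * (y - x)" for a q x y :: real
    by (simp add: algebra_simps)
  have g: "hypoexp_alloc_density {1..n} (\<lambda>k. t / l k) i s = g t s" if "0 < t" "0 < s" for t s
  proof -
    have "hypoexp_coeff {1..n} (\<lambda>k. t / l k) k * (t / l k / (t / l i - t / l k)) * (exp (- (t / l k) * s) - exp (- (t / l i) * s)) =
        A_coeff n l k * (l i / (l i - l k)) * (exp (- (s / l i) * t) - exp (- (s / l k) * t))" if k: "k \<in> {1..n} - {i}" for k
    proof -
      have neq: "l i \<noteq> l k" "0 < l i" "0 < l k"
        using inj i k l_pos by (auto dest: inj_onD)
      \<comment> \<open>In terms of the rates the quotient has the opposite sign; this is absorbed
        by swapping the two exponentials via \<open>flip\<close>.\<close>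
      define q where "q = l i / (l i - l k)"
      have "t / l k / (t / l i - t / l k) = - q"
        using neq \<open>0 < t\<close> by (simp add: q_def field_simps)
      moreover have "hypoexp_coeff {1..n} (\<lambda>k. t / l k) k = A_coeff n l k"
        using k \<open>0 < t\<close> inj by (intro hypoexp_coeff_rates) auto
      ultimately show ?thesis
        unfolding exp_swap[of t] q_def[symmetric] by (simp only: flip)
    qed
    then have "(\<Sum>k\<in>{1..n} - {i}. hypoexp_coeff {1..n} (\<lambda>k. t / l k) k * (t / l k / (t / l i - t / l k)) *
          (exp (- (t / l k) * s) - exp (- (t / l i) * s))) =
        (\<Sum>k\<in>{1..n} - {i}. A_coeff n l k * (l i / (l i - l k)) * (exp (- (s / l i) * t) - exp (- (s / l k) * t)))"
      by (rule sum.cong[OF refl])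
    moreover have "s * hypoexp_coeff {1..n} (\<lambda>k. t / l k) i * (t / l i) * exp (- (t / l i) * s) =
        s / l i * A_coeff n l i * (t * exp (- (s / l i) * t))"
      unfolding hypoexp_coeff_rates[OF \<open>0 < t\<close> inj i] exp_swap[of t i s] by simp
    ultimately show ?thesis
      using that by (simp add: hypoexp_alloc_density_def g_def)
  qed
  have inj': "inj_on (\<lambda>k. t / l k) {1..n}" if "0 < t" for t
  proof (rule inj_onI)
    fix x y assume xy: "x \<in> {1..n}" "y \<in> {1..n}" and "t / l x = t / l y"
    then have "l x = l y"
      using that l_pos[of x] l_pos[of y] by (simp add: divide_inverse)
    then show "x = y" by (rule inj_onD[OF inj _ xy])
  qed
  show "has_density_pos (allocation_measure M (X i) S)
    (\<lambda>s. - (s / l i) * A_coeff n l i * deriv (laplace_stieltjes M \<Theta>) (s / l i) +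
         (\<Sum>k\<in>{1..n} - {i}. A_coeff n l k * (l i / (l i - l k)) *
            (laplace_stieltjes M \<Theta> (s / l i) - laplace_stieltjes M \<Theta> (s / l k))))"
  proof (rule has_density_pos_mixture[OF prob_space_axioms \<Theta>, of g])
    show "(\<lambda>(t, s). g t s) \<in> borel_measurable (borel \<Otimes>\<^sub>M borel)"
      unfolding g_def by measurable
    show "AE \<omega> in M. \<forall>s>0. 0 \<le> g (\<Theta> \<omega>) s"
      using \<Theta>_pos
    proof eventually_elim
      case (elim \<omega>)
      have "0 \<le> hypoexp_alloc_density {1..n} (\<lambda>k. \<Theta> \<omega> / l k) i s" for s
        using elim l_pos i inj' by (intro hypoexp_alloc_density_nonneg) auto
      then show ?case using g elim by metis
    qed
    fix s :: real assume s: "0 < s"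
    note int = integrable_laplace_terms[OF s]
    have int_sum: "integrable M (\<lambda>\<omega>. \<Sum>k\<in>{1..n} - {i}. A_coeff n l k * (l i / (l i - l k)) *
        (exp (- (s / l i) * \<Theta> \<omega>) - exp (- (s / l k) * \<Theta> \<omega>)))"
      using int i by (intro Bochner_Integration.integrable_sum integrable_mult_right Bochner_Integration.integrable_diff) auto
    have int_i: "integrable M (\<lambda>\<omega>. s / l i * A_coeff n l i * (\<Theta> \<omega> * exp (- (s / l i) * \<Theta> \<omega>)))"
      using int(2)[OF i] by (rule integrable_mult_right)
    show "integrable M (\<lambda>\<omega>. g (\<Theta> \<omega>) s)"
      unfolding g_def by (rule Bochner_Integration.integrable_add[OF int_i int_sum])
    have "(\<integral>\<omega>. (\<Sum>k\<in>{1..n} - {i}. A_coeff n l k * (l i / (l i - l k)) *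
        (exp (- (s / l i) * \<Theta> \<omega>) - exp (- (s / l k) * \<Theta> \<omega>))) \<partial>M) =
        (\<Sum>k\<in>{1..n} - {i}. A_coeff n l k * (l i / (l i - l k)) *
            (laplace_stieltjes M \<Theta> (s / l i) - laplace_stieltjes M \<Theta> (s / l k)))"
      unfolding laplace_stieltjes_def using int(1) i
      by (subst Bochner_Integration.integral_sum) (auto intro!: sum.cong)
    moreover have "(\<integral>\<omega>. s / l i * A_coeff n l i * (\<Theta> \<omega> * exp (- (s / l i) * \<Theta> \<omega>)) \<partial>M) =
        - (s / l i) * A_coeff n l i * deriv (laplace_stieltjes M \<Theta>) (s / l i)"
      unfolding integral_mult_right_zero deriv_laplace[OF s i] by simp
    ultimately show "- (s / l i) * A_coeff n l i * deriv (laplace_stieltjes M \<Theta>) (s / l i) +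
         (\<Sum>k\<in>{1..n} - {i}. A_coeff n l k * (l i / (l i - l k)) *
            (laplace_stieltjes M \<Theta> (s / l i) - laplace_stieltjes M \<Theta> (s / l k))) = (\<integral>\<omega>. g (\<Theta> \<omega>) s \<partial>M)"
      unfolding g_def Bochner_Integration.integral_add[OF int_i int_sum] by simp
  next
    fix B :: "real set" assume B [measurable]: "B \<in> sets borel"
    have "emeasure (allocation_measure M (X i) S) B = (\<integral>\<^sup>+\<omega>. ennreal (X i \<omega>) * indicator B (S \<omega>) \<partial>M)"
      using i B by (rule emeasure_allocation_measure)
    also have "\<dots> = (\<integral>\<^sup>+\<omega>. \<integral>\<^sup>+x. ennreal (x i) * indicator B (\<Sum>k\<in>{1..n}. x k) \<partial>K (\<Theta> \<omega>) \<partial>M)"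
      by (rule nn_integral_alloc[OF i]) measurable
    also have "\<dots> = (\<integral>\<^sup>+\<omega>. (\<integral>\<^sup>+s. ennreal (g (\<Theta> \<omega>) s) * indicator {0<..} s * indicator B s \<partial>lborel) \<partial>M)"
    proof (rule nn_integral_cong_AE, use \<Theta>_pos cond in eventually_elim)
      case (elim \<omega>)
      interpret K: prob_space "K (\<Theta> \<omega>)" by (rule prob_space_K)
      have "(\<integral>\<^sup>+x. ennreal (x i) * indicator B (\<Sum>k\<in>{1..n}. x k) \<partial>K (\<Theta> \<omega>)) =
          (\<integral>\<^sup>+s. ennreal (hypoexp_alloc_density {1..n} (\<lambda>k. \<Theta> \<omega> / l k) i s) * indicator B s \<partial>lborel)"
        using elim l_pos i inj' by (intro K.nn_integral_hypoexp_alloc) auto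
      also have "\<dots> = (\<integral>\<^sup>+s. ennreal (g (\<Theta> \<omega>) s) * indicator {0<..} s * indicator B s \<partial>lborel)"
        using elim g by (intro nn_integral_lborel_pos_cong) (auto simp: hypoexp_alloc_density_def)
      finally show ?case .
    qed
    finally show "emeasure (allocation_measure M (X i) S) B = \<dots>" .
  qed (simp add: allocation_measure_def)
qed

section \<open>Equal rates\<close>

lemma X_nonneg: "AE \<omega> in M. \<forall>i\<in>{1..n}. 0 \<le> X i \<omega>"
proof -
  have "AE \<omega> in M. 0 \<le> (\<lambda>k\<in>{1..n}. X k \<omega>) i" if i: "i \<in> {1..n}" for i
  proof (rule regular_cond_distr_AE[OF prob_space_axioms K])
    show "Measurable.pred (PiM {1..n} (\<lambda>_. borel)) (\<lambda>x. 0 \<le> (x i :: real))"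
      using i by measurable
    show "AE \<omega> in M. AE x in K (\<Theta> \<omega>). 0 \<le> x i"
      using cond
    proof eventually_elim
      case (elim \<omega>)
      then have D: "distributed (K (\<Theta> \<omega>)) lborel (\<lambda>x. x i) (exponential_density (\<Theta> \<omega> / l i))"
        using i by simp
      \<comment> \<open>Under the kernel, coordinate \<open>i\<close> has a density that vanishes on
        the negative half-line.\<close>
      have "AE y in distr (K (\<Theta> \<omega>)) lborel (\<lambda>x. x i). 0 \<le> y"
        unfolding distributed_distr_eq_density[OF D] using distributed_borel_measurable[OF D]
        by (subst AE_density) (auto simp: erlang_density_def)
      then show ?case
        by (rule AE_distrD[OF distributed_measurable[OF D]])
    qed
  qed
  then show ?thesis
    by (simp add: AE_finite_all)
qed

text \<open>The mean of \<open>S\<close> on the event \<open>S \<in> B\<close> splits into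
  \<open>n\<close> equal contributions. Stated relative to the law of \<open>S\<close>, this serves
  both the Lebesgue density and the Radon-Nikodym derivative.\<close>

lemma allocation_measure_equal:
  assumes c: "\<And>i. i \<in> {1..n} \<Longrightarrow> l i = c" and i: "i \<in> {1..n}"
  shows "allocation_measure M (X i) S = density (distr M borel S) (\<lambda>s. ennreal (s / real n))"
proof (rule measure_eqI)
  fix B assume "B \<in> sets (allocation_measure M (X i) S)"
  then have B [measurable]: "B \<in> sets borel" by (simp add: allocation_measure_def)
  have n0: "0 < real n" using n by simp
  \<comment> \<open>The equality is proved conditionally, where all coordinates share the rate
    \<open>\<Theta> \<omega> / c\<close>, and then averaged.\<close>
  have eq: "(\<integral>\<^sup>+\<omega>. ennreal (X j \<omega>) * indicator B (S \<omega>) \<partial>M) = (\<integral>\<^sup>+\<omega>. ennreal (X i \<omega>) * indicator B (S \<omega>) \<partial>M)"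
    if j: "j \<in> {1..n}" for j
    unfolding nn_integral_alloc[OF i borel_measurable_indicator[OF B]] nn_integral_alloc[OF j borel_measurable_indicator[OF B]]
  proof (rule nn_integral_cong_AE, use \<Theta>_pos cond in eventually_elim)
    case (elim \<omega>)
    interpret K: prob_space "K (\<Theta> \<omega>)" by (rule prob_space_K)
    show ?case
      using elim i j c l_pos[OF i]
      by (intro K.nn_integral_iid_exponential_alloc_cong[where r = "\<Theta> \<omega> / c"]) auto
  qed
  have "emeasure (density (distr M borel S) (\<lambda>s. ennreal (s / real n))) B =
      (\<integral>\<^sup>+\<omega>. ennreal (S \<omega> / real n) * indicator B (S \<omega>) \<partial>M)"
    by (simp add: emeasure_density nn_integral_distr)
  also have "\<dots> = (\<integral>\<^sup>+\<omega>. ennreal (1 / real n) * (\<Sum>j\<in>{1..n}. ennreal (X j \<omega>) * indicator B (S \<omega>)) \<partial>M)"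
  proof (rule nn_integral_cong_AE, use X_nonneg in eventually_elim)
    case (elim \<omega>)
    \<comment> \<open>\<open>ennreal\<close> is additive only on nonnegative reals, hence the use of
      \<open>X_nonneg\<close>.\<close>
    have "ennreal (S \<omega> / real n) = ennreal (1 / real n) * (\<Sum>j\<in>{1..n}. ennreal (X j \<omega>))"
    proof -
      have "(\<Sum>j\<in>{1..n}. ennreal (X j \<omega>)) = ennreal (S \<omega>)" "0 \<le> S \<omega>"
        using elim unfolding S by (auto simp del: One_nat_def intro!: sum_ennreal sum_nonneg)
      then show ?thesis using n0 by (simp flip: ennreal_mult)
    qed
    then show ?case by (simp add: sum_distrib_right mult.assoc)
  qed
  also have "\<dots> = ennreal (1 / real n) * (\<Sum>j\<in>{1..n}. (\<integral>\<^sup>+\<omega>. ennreal (X j \<omega>) * indicator B (S \<omega>) \<partial>M))"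
  proof -
    have "(\<integral>\<^sup>+\<omega>. (\<Sum>j\<in>{1..n}. ennreal (X j \<omega>) * indicator B (S \<omega>)) \<partial>M) =
        (\<Sum>j\<in>{1..n}. (\<integral>\<^sup>+\<omega>. ennreal (X j \<omega>) * indicator B (S \<omega>) \<partial>M))"
      by (rule nn_integral_sum) measurable
    then show ?thesis
      by (subst nn_integral_cmult) simp_all
  qed
  also have "\<dots> = ennreal (1 / real n) * (of_nat n * (\<integral>\<^sup>+\<omega>. ennreal (X i \<omega>) * indicator B (S \<omega>) \<partial>M))"
    by (simp add: eq)
  \<comment> \<open>The finite factors \<open>1 / n\<close> and \<open>n\<close> are combined first,
    which is sound also when the integral is infinite.\<close>
  also have "\<dots> = (\<integral>\<^sup>+\<omega>. ennreal (X i \<omega>) * indicator B (S \<omega>) \<partial>M)"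
    using n0 by (simp add: ennreal_of_nat_eq_real_of_nat flip: mult.assoc ennreal_mult)
  also have "\<dots> = emeasure (allocation_measure M (X i) S) B"
    using emeasure_allocation_measure[OF i B] by simp
  finally show "emeasure (allocation_measure M (X i) S) B = emeasure (density (distr M borel S) (\<lambda>s. ennreal (s / real n))) B"
    by simp
qed (simp add: allocation_measure_def)

text \<open>All three claims rest on \<open>allocation_measure_equal\<close>: composing densities
  gives existence, uniqueness of Lebesgue densities gives the formula for any other version, and
  uniqueness of the Radon-Nikodym derivative gives the conditional mean.\<close>

lemma equal_rates:
  assumes c: "\<And>i. i \<in> {1..n} \<Longrightarrow> l i = c" and i: "i \<in> {1..n}"
    and f: "has_density_pos (distr M borel S) f"
  shows "expected_allocation_density M (X i) S (\<lambda>s. s / real n * f s)"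
    and "expected_allocation_density M (X i) S \<xi> \<Longrightarrow>
      AE s in distr M borel S. 0 < s \<longrightarrow> \<xi> s = s / real n * f s"
    and "AE s in distr M borel S. 0 < s \<longrightarrow> cond_mean_given M (X i) S s = ennreal (s / real n)"
proof -
  let ?f = "\<lambda>s. ennreal (f s) * indicator {0<..} s" and ?h = "\<lambda>s. s / real n * f s"
  have n0: "0 < real n" using n by simp
  have meas: "set_borel_measurable borel {0<..} f" and nonneg: "AE s in lborel. 0 < s \<longrightarrow> 0 \<le> f s"
    and distr: "distr M borel S = density lborel ?f"
    using f by (auto simp: has_density_pos_def)
  have ind: "ennreal (p s) * indicator {0<..} s = ennreal (indicator {0<..} s *\<^sub>R p s)" for p :: "real \<Rightarrow> real" and s
    by (auto split: split_indicator)
  have meas_pos: "(\<lambda>s. ennreal (p s) * indicator {0<..} s) \<in> borel_measurable borel"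
    if "set_borel_measurable borel {0<..} p" for p :: "real \<Rightarrow> real"
    using that unfolding set_borel_measurable_def ind by measurable
  have meas_h: "set_borel_measurable borel {0<..} ?h"
  proof -
    have "(\<lambda>s. s / real n * (indicator {0<..} s *\<^sub>R f s)) \<in> borel_measurable borel"
      using meas unfolding set_borel_measurable_def by measurable
    then show ?thesis unfolding set_borel_measurable_def by (simp add: ac_simps)
  qed
  have alloc_eq: "allocation_measure M (X i) S = density (distr M borel S) (\<lambda>s. ennreal (s / real n))"
    using c i by (rule allocation_measure_equal)
  have alloc: "allocation_measure M (X i) S = density lborel (\<lambda>s. ennreal (?h s) * indicator {0<..} s)"
  proof -
    have "density (density lborel ?f) (\<lambda>s. ennreal (s / real n)) = density lborel (\<lambda>s. ?f s * ennreal (s / real n))"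
      using meas_pos[OF meas] by (subst density_density_eq) simp_all
    also have "\<dots> = density lborel (\<lambda>s. ennreal (?h s) * indicator {0<..} s)"
    proof (rule density_cong)
      show "(\<lambda>s. ?f s * ennreal (s / real n)) \<in> borel_measurable lborel"
        using borel_measurable_times_ennreal[OF meas_pos[OF meas], of "\<lambda>s. ennreal (s / real n)"] by simp
      show "(\<lambda>s. ennreal (?h s) * indicator {0<..} s) \<in> borel_measurable lborel"
        using meas_pos[OF meas_h] by simp
      \<comment> \<open>Multiplicativity of \<open>ennreal\<close> needs both factors nonnegative,
        which for \<open>f\<close> is known only almost everywhere.\<close>
      show "AE s in lborel. ?f s * ennreal (s / real n) = ennreal (?h s) * indicator {0<..} s"
        using nonneg
      proof eventually_elim
        case (elim s)
        then show ?case
          using n0 ennreal_mult[of "s / real n" "f s"] by (auto simp: mult.commute split: split_indicator)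
      qed
    qed
    finally show ?thesis
      unfolding alloc_eq distr .
  qed
  show "expected_allocation_density M (X i) S ?h"
    unfolding expected_allocation_density_def has_density_pos_def
    using nonneg meas_h alloc n0 by (auto elim!: eventually_mono)
  show "AE s in distr M borel S. 0 < s \<longrightarrow> \<xi> s = ?h s" if \<xi>: "expected_allocation_density M (X i) S \<xi>"
  proof -
    have m: "set_borel_measurable borel {0<..} \<xi>" and nn: "AE s in lborel. 0 < s \<longrightarrow> 0 \<le> \<xi> s"
      and d: "allocation_measure M (X i) S = density lborel (\<lambda>s. ennreal (\<xi> s) * indicator {0<..} s)"
      using \<xi> by (auto simp: expected_allocation_density_def has_density_pos_def)
    \<comment> \<open>Uniqueness compares the \<open>ennreal\<close> versions; the sign conditions
      on \<open>\<xi>\<close> and \<open>f\<close> then recover equality of the real values.\<close>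
    have "AE s in lborel. ennreal (\<xi> s) * indicator {0<..} s = ennreal (?h s) * indicator {0<..} s"
      using alloc d meas_pos[OF m] meas_pos[OF meas_h]
      by (intro sigma_finite_measure.density_unique_iff[OF sigma_finite_lborel, THEN iffD1]) auto
    with nn nonneg have "AE s in lborel. 0 < s \<longrightarrow> \<xi> s = ?h s"
      by eventually_elim (use n0 in \<open>auto simp: ennreal_inj\<close>)
    \<comment> \<open>Since \<open>S\<close> has a Lebesgue density, Lebesgue null sets are null for
      its law.\<close>
    then show ?thesis
      unfolding distr using meas_pos[OF meas] by (subst AE_density) (auto elim!: eventually_mono)
  qed
  interpret S: prob_space "distr M borel S" by (rule prob_space_distr) simp
  have "AE s in distr M borel S. ennreal (s / real n) = cond_mean_given M (X i) S s"
    unfolding cond_mean_given_def alloc_eq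
    by (rule S.RN_deriv_unique) simp_all
  then show "AE s in distr M borel S. 0 < s \<longrightarrow> cond_mean_given M (X i) S s = ennreal (s / real n)"
    by (auto elim!: eventually_mono)
qed

end

theorem proposition3:
  fixes M :: "'a measure"
    and \<Theta> :: "'a \<Rightarrow> real"
    and X :: "nat \<Rightarrow> 'a \<Rightarrow> real"
    and S :: "'a \<Rightarrow> real"
    and n :: nat
    and l :: "nat \<Rightarrow> real"
    and K :: "real \<Rightarrow> (nat \<Rightarrow> real) measure"
  assumes "prob_space M"
    and "\<Theta> \<in> borel_measurable M"
    and "\<P>(\<omega> in M. 0 < \<Theta> \<omega>) = 1"
    and "\<forall>u>0. laplace_stieltjes M \<Theta> differentiable (at u)"
    and "1 \<le> n"
    and "\<forall>i\<in>{1..n}. 0 < l i"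
    and "\<forall>i\<in>{1..n}. X i \<in> borel_measurable M"
    and "regular_cond_distr M (PiM {1..n} (\<lambda>_. borel)) (\<lambda>\<omega>. \<lambda>i\<in>{1..n}. X i \<omega>) borel \<Theta> K"
    and "AE \<theta> in distr M borel \<Theta>.
           prob_space.indep_vars (K \<theta>) (\<lambda>_. borel) (\<lambda>i x. x i) {1..n} \<and>
           (\<forall>i\<in>{1..n}. distributed (K \<theta>) lborel (\<lambda>x. x i) (exponential_density (\<theta> / l i)))"
    and "S = (\<lambda>\<omega>. \<Sum>i\<in>{1..n}. X i \<omega>)"
  shows
    "(inj_on l {1..n} \<longrightarrow>
        has_density_pos (distr M borel S)
          (\<lambda>s. - (\<Sum>k\<in>{1..n}. A_coeff n l k / l k * deriv (laplace_stieltjes M \<Theta>) (s / l k))) \<and>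
        (\<forall>i\<in>{1..n}. expected_allocation_density M (X i) S
          (\<lambda>s. - (s / l i) * A_coeff n l i * deriv (laplace_stieltjes M \<Theta>) (s / l i) +
               (\<Sum>k\<in>{1..n} - {i}. A_coeff n l k * (l i / (l i - l k)) *
                  (laplace_stieltjes M \<Theta> (s / l i) - laplace_stieltjes M \<Theta> (s / l k)))))) \<and>
     (\<forall>c f\<^sub>S. (\<forall>i\<in>{1..n}. l i = c) \<longrightarrow> has_density_pos (distr M borel S) f\<^sub>S \<longrightarrow>
        (\<forall>i\<in>{1..n}.
           (\<exists>\<xi>. expected_allocation_density M (X i) S \<xi>) \<and>
           (\<forall>\<xi>. expected_allocation_density M (X i) S \<xi> \<longrightarrow>
              (AE s in distr M borel S. 0 < s \<longrightarrow> \<xi> s = s / real n * f\<^sub>S s)) \<and>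
           (AE s in distr M borel S. 0 < s \<longrightarrow>
              cond_mean_given M (X i) S s = ennreal (s / real n))))"
proof -
  interpret prob_space M by fact
  have "AE \<omega> in M. 0 < \<Theta> \<omega>"
    using assms(2,3) by (subst prob_Collect_eq_1[symmetric]) simp_all
  moreover have "AE \<omega> in M. prob_space.indep_vars (K (\<Theta> \<omega>)) (\<lambda>_. borel) (\<lambda>i x. x i) {1..n} \<and>
      (\<forall>i\<in>{1..n}. distributed (K (\<Theta> \<omega>)) lborel (\<lambda>x. x i) (exponential_density (\<Theta> \<omega> / l i)))"
    by (rule AE_distrD[OF assms(2,9)])
  ultimately interpret exponential_mixture M \<Theta> X S n l K
    using assms by unfold_locales blast+
  have "(\<exists>\<xi>. expected_allocation_density M (X i) S \<xi>) \<and>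
      (\<forall>\<xi>. expected_allocation_density M (X i) S \<xi> \<longrightarrow>
         (AE s in distr M borel S. 0 < s \<longrightarrow> \<xi> s = s / real n * f s)) \<and>
      (AE s in distr M borel S. 0 < s \<longrightarrow> cond_mean_given M (X i) S s = ennreal (s / real n))"
    if "\<forall>i\<in>{1..n}. l i = c" "has_density_pos (distr M borel S) f" "i \<in> {1..n}" for c f i
    using equal_rates[OF bspec[OF that(1)] that(3,2)] by blast
  then show ?thesis
    using has_density_sum expected_allocation_density_distinct by blast
qed

end
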